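(* Let $k,d$ be positive integers and $0\le l'<l\le d$ integers with $k\ge l$. For every $\delta>0$ there exists an instance $v_1,\dots,v_n\in\mathbb{R}^d$ of the problem of minimizing $\big(E_{l'}(V_SV_S^\top)/E_l(V_SV_S^\top)\big)^{1/(l-l')}$ over $S\subseteq[n]$ with $|S|=k$ such that $\mathrm{OPT}\ge\big(\frac{k}{k-l'}-\delta\big)\mathrm{CP}$. This holds both for the problem without repetitions (with relaxation constraints $\sum_ix_i=k$, $0\le x_i\le1$) and with repetitions (multisets $S$; relaxation constraints $\sum_ix_i=k$, $x_i\ge0$).
   Context: $V_S$ is the matrix with columns $v_i$, $i\in S$; $E_j(M)$ is the $j$-th elementary symmetric polynomial of the eigenvalues of $M$. $\mathrm{OPT}$ is the optimal integral value, and $\mathrm{CP}$ is the optimal value of the relaxation minimizing $\big(E_{l'}(\sum_ix_iv_iv_i^\top)/E_l(\sum_ix_iv_iv_i^\top)\big)^{1/(l-l')}$ under the stated constraints. *)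

theory Defs
  imports
    "HOL-Library.Extended_Real"
    "HOL-Library.Multiset"
    "Jordan_Normal_Form.Char_Poly"
begin

definition elem_sym :: "nat \<Rightarrow> real list \<Rightarrow> real" where
  "elem_sym j xs = (\<Sum>I | I \<subseteq> {..<length xs} \<and> card I = j. \<Prod>i\<in>I. xs ! i)"

(* Only applied to symmetric real matrices: their characteristic polynomial splits over the
   reals, so its real roots with multiplicity are all the eigenvalues.  Sorting merely
   turns the multiset of eigenvalues into a list. *)
definition eigenvalue_list :: "real mat \<Rightarrow> real list" where
  "eigenvalue_list M = sorted_list_of_multiset (proots (char_poly M))"

definition E :: "nat \<Rightarrow> real mat \<Rightarrow> real" where
  "E j M = elem_sym j (eigenvalue_list M)"

(* Points with E l M = 0 (where rank M < l) get the value infinity.  This includes the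
   case 0 / 0; HOL's convention x / 0 = 0 would make them optimal. *)
definition ratio_obj :: "nat \<Rightarrow> nat \<Rightarrow> real mat \<Rightarrow> ereal" where
  "ratio_obj l' l M =
     (if E l M = 0 then \<infinity> else ereal ((E l' M / E l M) powr (1 / real (l - l'))))"

(* The matrix V_S whose columns are v i for i in S, repeated according to multiplicity;
   an ordinary index set S is passed as mset_set S. *)
definition sub_mat :: "nat \<Rightarrow> (nat \<Rightarrow> real vec) \<Rightarrow> nat multiset \<Rightarrow> real mat" where
  "sub_mat d v S = mat_of_cols d (map v (sorted_list_of_multiset S))"

(* The sum of x i * (v i) (v i)^T over i = 1..n, written entrywise. *)
definition weighted_gram :: "nat \<Rightarrow> nat \<Rightarrow> (nat \<Rightarrow> real vec) \<Rightarrow> (nat \<Rightarrow> real) \<Rightarrow> real mat" where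
  "weighted_gram d n v x = mat d d (\<lambda>(a, b). \<Sum>i=1..n. x i * (v i $ a * v i $ b))"

definition OPT_norep ::
  "nat \<Rightarrow> nat \<Rightarrow> nat \<Rightarrow> nat \<Rightarrow> nat \<Rightarrow> (nat \<Rightarrow> real vec) \<Rightarrow> ereal" where
  "OPT_norep d k l' l n v =
     (INF S \<in> {S. S \<subseteq> {1..n} \<and> card S = k}.
        ratio_obj l' l (sub_mat d v (mset_set S) * (sub_mat d v (mset_set S))\<^sup>T))"

definition OPT_rep ::
  "nat \<Rightarrow> nat \<Rightarrow> nat \<Rightarrow> nat \<Rightarrow> nat \<Rightarrow> (nat \<Rightarrow> real vec) \<Rightarrow> ereal" where
  "OPT_rep d k l' l n v =
     (INF S \<in> {S. set_mset S \<subseteq> {1..n} \<and> size S = k}.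
        ratio_obj l' l (sub_mat d v S * (sub_mat d v S)\<^sup>T))"

definition CP_norep ::
  "nat \<Rightarrow> nat \<Rightarrow> nat \<Rightarrow> nat \<Rightarrow> nat \<Rightarrow> (nat \<Rightarrow> real vec) \<Rightarrow> ereal" where
  "CP_norep d k l' l n v =
     (INF x \<in> {x. (\<Sum>i=1..n. x i) = real k \<and> (\<forall>i\<in>{1..n}. 0 \<le> x i \<and> x i \<le> 1)}.
        ratio_obj l' l (weighted_gram d n v x))"

definition CP_rep ::
  "nat \<Rightarrow> nat \<Rightarrow> nat \<Rightarrow> nat \<Rightarrow> nat \<Rightarrow> (nat \<Rightarrow> real vec) \<Rightarrow> ereal" where
  "CP_rep d k l' l n v =
     (INF x \<in> {x. (\<Sum>i=1..n. x i) = real k \<and> (\<forall>i\<in>{1..n}. 0 \<le> x i)}.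
        ratio_obj l' l (weighted_gram d n v x))"

end

theory Submission
  imports Defs "HOL-Analysis.Convex" "HOL-Combinatorics.Permutations"
begin

text \<open>
  Take \<open>k\<close> copies each of the vectors \<open>t e\<^sub>a\<close> for \<open>a < l'\<close> (heavy) and \<open>e\<^sub>a\<close> for \<open>l' \<le> a < l\<close> (light).
  All Gram matrices are diagonal of rank at most \<open>l\<close>, so an integral solution of finite value has to
  spend at least one vector on each heavy axis; the light axes share the remaining \<open>k - l'\<close> vectors,
  and AM-GM bounds the objective below by \<open>(l - l') / (k - l')\<close> for every \<open>t\<close>. The fractional solution
  that puts mass \<open>1 / t\<close> on each heavy axis already has diagonal entry \<open>t\<close> there, and spreading the
  rest over the light axes its value tends to \<open>(l - l') / k\<close> as \<open>t\<close> grows.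
\<close>

section \<open>Elementary symmetric polynomials of diagonal matrices\<close>

text \<open>A permutation carrying one list to the other also permutes the index sets of size
  \<open>j\<close>. This frees the later computation from the sorting in
  \<open>eigenvalue_list\<close>: the diagonal may be read in its own order.\<close>

lemma elem_sym_mset_cong:
  assumes "mset xs = mset ys"
  shows "elem_sym j xs = elem_sym j ys"
proof -
  obtain p where p: "p permutes {..<length ys}" "permute_list p ys = xs"
    using mset_eq_permutation[OF assms] by metis
  have len: "length xs = length ys"
    using assms by (rule mset_eq_length)
  have bij: "bij_betw ((`) p) {I. I \<subseteq> {..<length ys} \<and> card I = j} {I. I \<subseteq> {..<length ys} \<and> card I = j}"
  proof (rule bij_betw_byWitness[where f' = "(`) (inv_into UNIV p)"])
    have q: "inv_into UNIV p permutes {..<length ys}"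
      using p(1) by (rule permutes_inv)
    have im: "r ` I \<subseteq> {..<length ys} \<and> card (r ` I) = card I"
      if "r permutes {..<length ys}" "I \<subseteq> {..<length ys}" for r I
      using that by (metis card_image image_mono inj_on_subset permutes_image permutes_inj_on)
    show "(`) p ` {I. I \<subseteq> {..<length ys} \<and> card I = j} \<subseteq> {I. I \<subseteq> {..<length ys} \<and> card I = j}"
      using im[OF p(1)] by blast
    show "(`) (inv_into UNIV p) ` {I. I \<subseteq> {..<length ys} \<and> card I = j} \<subseteq> {I. I \<subseteq> {..<length ys} \<and> card I = j}"
      using im[OF q] by blast
  qed (use p(1) in \<open>simp_all add: image_comp permutes_inv_o\<close>)
  have "elem_sym j xs = (\<Sum>I | I \<subseteq> {..<length ys} \<and> card I = j. \<Prod>i\<in>p ` I. ys ! i)"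
    unfolding elem_sym_def len
  proof (rule sum.cong)
    fix I assume I: "I \<in> {I. I \<subseteq> {..<length ys} \<and> card I = j}"
    have "(\<Prod>i\<in>I. xs ! i) = (\<Prod>i\<in>I. ys ! p i)"
      using I p by (intro prod.cong) (auto simp flip: p(2) simp: permute_list_nth)
    also have "\<dots> = (\<Prod>i\<in>p ` I. ys ! i)"
      using permutes_inj_on[OF p(1)] by (simp add: prod.reindex)
    finally show "(\<Prod>i\<in>I. xs ! i) = (\<Prod>i\<in>p ` I. ys ! i)" .
  qed simp
  also have "\<dots> = elem_sym j ys"
    unfolding elem_sym_def by (rule sum.reindex_bij_betw[OF bij])
  finally show ?thesis .
qed

definition diag_of :: "nat \<Rightarrow> (nat \<Rightarrow> real) \<Rightarrow> real mat" where
  "diag_of d f = mat d d (\<lambda>(a, b). if a = b then f a else 0)"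

text \<open>A diagonal matrix is upper triangular, so its characteristic polynomial is the product
  of the linear factors given by the diagonal, and the roots can be read off with
  multiplicity.\<close>

lemma mset_eigenvalue_list_diag_of: "mset (eigenvalue_list (diag_of d f)) = mset (map f [0..<d])"
proof -
  have "diag_mat (diag_of d f) = map f [0..<d]"
    by (auto simp: diag_mat_def diag_of_def)
  moreover have "char_poly (diag_of d f) = (\<Prod>a\<leftarrow>diag_mat (diag_of d f). [:- a, 1:])"
    by (rule char_poly_upper_triangular[of _ d]) (auto simp: diag_of_def)
  ultimately have "proots (char_poly (diag_of d f)) = proots (\<Prod>a\<leftarrow>map f [0..<d]. [:- a, 1:])"
    by simp
  also have "proots (\<Prod>a\<leftarrow>xs. [:- a, 1:]) = mset xs" for xs :: "real list"
  proof (induction xs)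
    case (Cons a xs)
    have "(\<Prod>a\<leftarrow>xs. [:- a, 1:]) \<noteq> 0"
      by (auto simp: prod_list_zero_iff)
    then show ?case
      using Cons proots_mult[of "[:- a, 1:]" "\<Prod>a\<leftarrow>xs. [:- a, 1:]"] by simp
  qed simp
  finally show ?thesis
    by (simp add: eigenvalue_list_def)
qed

lemma E_diag_of: "E j (diag_of d f) = (\<Sum>I | I \<subseteq> {..<d} \<and> card I = j. prod f I)"
proof -
  have "E j (diag_of d f) = elem_sym j (map f [0..<d])"
    unfolding E_def by (rule elem_sym_mset_cong[OF mset_eigenvalue_list_diag_of])
  also have "\<dots> = (\<Sum>I | I \<subseteq> {..<d} \<and> card I = j. prod f I)"
    unfolding elem_sym_def by (auto intro!: sum.cong prod.cong)
  finally show ?thesis .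
qed

text \<open>An index set that leaves \<open>{..<l}\<close> picks up a zero factor.\<close>

lemma E_diag_of_support:
  assumes "l \<le> d" and "\<And>a. l \<le> a \<Longrightarrow> f a = 0"
  shows "E j (diag_of d f) = (\<Sum>I | I \<subseteq> {..<l} \<and> card I = j. prod f I)"
  unfolding E_diag_of
proof (rule sum.mono_neutral_right)
  show "\<forall>I\<in>{I. I \<subseteq> {..<d} \<and> card I = j} - {I. I \<subseteq> {..<l} \<and> card I = j}. prod f I = 0"
  proof
    fix I assume I: "I \<in> {I. I \<subseteq> {..<d} \<and> card I = j} - {I. I \<subseteq> {..<l} \<and> card I = j}"
    then obtain a where "a \<in> I" "l \<le> a"
      by force
    with I assms(2) show "prod f I = 0"
      by (metis (mono_tags, lifting) Diff_iff finite_lessThan finite_subset mem_Collect_eq prod_zero)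
  qed
qed (use assms(1) in auto)

text \<open>The only \<open>l\<close>-subset of \<open>{..<l}\<close> is the whole set, so
  \<open>E l\<close> is a single product. It vanishes, making the objective infinite, exactly when
  one of the first \<open>l\<close> diagonal entries is zero.\<close>

lemma ratio_obj_diag_of:
  assumes "l \<le> d" and "\<And>a. l \<le> a \<Longrightarrow> f a = 0"
  shows "ratio_obj l' l (diag_of d f) =
    (if (\<Prod>a<l. f a) = 0 then \<infinity>
     else ereal (((\<Sum>I | I \<subseteq> {..<l} \<and> card I = l'. prod f I) / (\<Prod>a<l. f a)) powr (1 / real (l - l'))))"
proof -
  have "{I. I \<subseteq> {..<l} \<and> card I = l} = {{..<l}}"
    using card_subset_eq[of "{..<l}"] by auto
  then have "E l (diag_of d f) = (\<Prod>a<l. f a)"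
    by (simp add: E_diag_of_support[OF assms])
  then show ?thesis
    by (simp add: ratio_obj_def E_diag_of_support[OF assms])
qed

section \<open>Gram matrices of the instance with copies of scaled axes\<close>

text \<open>An integral choice is the fractional point given by its multiplicities, so both problems
  can be evaluated through \<open>weighted_gram\<close>.\<close>

lemma gram_sub_mat:
  assumes "set_mset S \<subseteq> {1..n}"
  shows "sub_mat d v S * (sub_mat d v S)\<^sup>T = weighted_gram d n v (\<lambda>i. real (count S i))"
proof (rule eq_matI)
  fix a b
  assume "a < dim_row (weighted_gram d n v (\<lambda>i. real (count S i)))"
    and "b < dim_col (weighted_gram d n v (\<lambda>i. real (count S i)))"
  then have ab: "a < d" "b < d"
    by (auto simp: weighted_gram_def)
  define xs where "xs = sorted_list_of_multiset S"
  have "(sub_mat d v S * (sub_mat d v S)\<^sup>T) $$ (a, b) =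
      (\<Sum>i = 0..<length xs. v (xs ! i) $ a * v (xs ! i) $ b)"
    using ab by (simp add: sub_mat_def scalar_prod_def mat_of_cols_def flip: xs_def)
  also have "\<dots> = (\<Sum>i\<leftarrow>xs. v i $ a * v i $ b)"
    by (simp add: sum_list_sum_nth)
  also have "\<dots> = (\<Sum>i\<in>#S. v i $ a * v i $ b)"
    by (simp add: xs_def flip: sum_mset_sum_list)
  also have "\<dots> = (\<Sum>i=1..n. real (count S i) * (v i $ a * v i $ b))"
    using assms
  proof (induction S)
    case (add i S)
    have "(\<Sum>j=1..n. real (count (add_mset i S) j) * (v j $ a * v j $ b)) =
        (\<Sum>j=1..n. (if j = i then v j $ a * v j $ b else 0) + real (count S j) * (v j $ a * v j $ b))"
      by (intro sum.cong) (auto simp: algebra_simps)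
    also have "\<dots> = v i $ a * v i $ b + (\<Sum>j=1..n. real (count S j) * (v j $ a * v j $ b))"
      using add.prems by (simp add: sum.distrib)
    finally show ?case
      using add by simp
  qed simp
  finally show "(sub_mat d v S * (sub_mat d v S)\<^sup>T) $$ (a, b) =
      weighted_gram d n v (\<lambda>i. real (count S i)) $$ (a, b)"
    using ab by (simp add: weighted_gram_def)
qed (auto simp: sub_mat_def weighted_gram_def)

text \<open>Indices start at 1 and fall into consecutive blocks of \<open>k\<close>; block
  \<open>a\<close> consists of copies of the axis vector \<open>a\<close> scaled by
  \<open>s a\<close>. With \<open>k\<close> copies, an axis can carry any mass up to
  \<open>k\<close> even under the constraint \<open>x i \<le> 1\<close>.\<close>

definition axis_copies :: "nat \<Rightarrow> nat \<Rightarrow> (nat \<Rightarrow> real) \<Rightarrow> nat \<Rightarrow> real vec" where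
  "axis_copies d k s i = vec d (\<lambda>a. if a = (i - 1) div k then s a else 0)"

text \<open>Index 0 must be excluded explicitly: truncated subtraction would put it on axis
  0.\<close>

definition copies :: "nat \<Rightarrow> nat \<Rightarrow> nat \<Rightarrow> nat set" where
  "copies n k a = {i \<in> {1..n}. (i - 1) div k = a}"

lemma weighted_gram_axis_copies:
  "weighted_gram d n (axis_copies d k s) x = diag_of d (\<lambda>a. (s a)\<^sup>2 * (\<Sum>i\<in>copies n k a. x i))"
proof (rule eq_matI)
  fix a b
  assume "a < dim_row (diag_of d (\<lambda>a. (s a)\<^sup>2 * (\<Sum>i\<in>copies n k a. x i)))"
    and "b < dim_col (diag_of d (\<lambda>a. (s a)\<^sup>2 * (\<Sum>i\<in>copies n k a. x i)))"
  then have ab: "a < d" "b < d"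
    by (auto simp: diag_of_def)
  have "weighted_gram d n (axis_copies d k s) x $$ (a, b) =
      (\<Sum>i=1..n. if (i - 1) div k = a then (if a = b then (s a)\<^sup>2 * x i else 0) else 0)"
    using ab by (auto simp: weighted_gram_def axis_copies_def power2_eq_square intro!: sum.cong)
  also have "\<dots> = (\<Sum>i\<in>copies n k a. if a = b then (s a)\<^sup>2 * x i else 0)"
    unfolding copies_def by (rule sum.inter_filter[symmetric]) simp
  also have "\<dots> = diag_of d (\<lambda>a. (s a)\<^sup>2 * (\<Sum>i\<in>copies n k a. x i)) $$ (a, b)"
    using ab by (auto simp: diag_of_def sum_distrib_left)
  finally show "weighted_gram d n (axis_copies d k s) x $$ (a, b) =
      diag_of d (\<lambda>a. (s a)\<^sup>2 * (\<Sum>i\<in>copies n k a. x i)) $$ (a, b)" .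
qed (auto simp: weighted_gram_def diag_of_def)

lemma copies_eq:
  assumes "0 < k" and "a < l"
  shows "copies (l * k) k a = {a * k + 1..a * k + k}"
proof -
  have *: "(i - 1) div k = a \<longleftrightarrow> a * k \<le> i - 1 \<and> i - 1 < a * k + k" for i
    using div_nat_eqI[of k a "i - 1"] div_times_less_eq_dividend[of "i - 1" k]
      dividend_less_div_times[OF assms(1), of "i - 1"] by (auto simp: mult.commute)
  have "Suc a * k \<le> l * k"
    using assms(2) by (intro mult_right_mono) auto
  then have "a * k + k \<le> l * k"
    by simp
  then show ?thesis
    unfolding copies_def * using assms(1) by auto
qed

lemma copies_empty:
  assumes "l \<le> a"
  shows "copies (l * k) k a = {}"
proof -
  have "(i - 1) div k < l" if "i \<in> {1..l * k}" for i
    using that by (auto simp: less_mult_imp_div_less)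
  then show ?thesis
    using assms unfolding copies_def by force
qed

lemma sum_copies:
  fixes x :: "nat \<Rightarrow> 'a::comm_monoid_add"
  shows "(\<Sum>a<l. \<Sum>i\<in>copies (l * k) k a. x i) = (\<Sum>i=1..l * k. x i)"
  unfolding copies_def by (rule sum.group) (auto simp: less_mult_imp_div_less)

lemma ratio_obj_axis_copies:
  fixes s x :: "nat \<Rightarrow> real" and k l :: nat
  defines "f \<equiv> \<lambda>a. (s a)\<^sup>2 * (\<Sum>i\<in>copies (l * k) k a. x i)"
  assumes "l \<le> d"
  shows "ratio_obj l' l (weighted_gram d (l * k) (axis_copies d k s) x) =
    (if (\<Prod>a<l. f a) = 0 then \<infinity>
     else ereal (((\<Sum>I | I \<subseteq> {..<l} \<and> card I = l'. prod f I) / (\<Prod>a<l. f a)) powr (1 / real (l - l'))))"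
  unfolding weighted_gram_axis_copies f_def
  by (rule ratio_obj_diag_of) (use assms in \<open>auto simp: copies_empty\<close>)

section \<open>The integral lower bound and the fractional limit\<close>

text \<open>Here \<open>c a\<close> counts the chosen vectors on axis \<open>a\<close> and
  \<open>f a\<close> is the diagonal entry. Keeping only the term \<open>I = {..<l'}\<close> of the
  numerator cancels the heavy entries, whatever their size. What remains is the inverse of the light
  product, which AM-GM controls because at most \<open>k - l'\<close> vectors are light.\<close>

lemma integral_ratio_lower_bound:
  fixes c :: "nat \<Rightarrow> nat" and f :: "nat \<Rightarrow> real"
  assumes "l' < l" and "l \<le> k" and "(\<Sum>a<l. c a) = k"
    and nonneg: "\<And>a. a < l \<Longrightarrow> 0 \<le> f a"
    and light: "\<And>a. l' \<le> a \<Longrightarrow> a < l \<Longrightarrow> f a = real (c a)"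
    and heavy: "\<And>a. a < l' \<Longrightarrow> c a = 0 \<Longrightarrow> f a = 0"
    and nz: "(\<Prod>a<l. f a) \<noteq> 0"
  shows "real (l - l') / real (k - l') \<le>
    ((\<Sum>I | I \<subseteq> {..<l} \<and> card I = l'. prod f I) / (\<Prod>a<l. f a)) powr (1 / real (l - l'))"
proof -
  define m where "m = l - l'"
  have m: "0 < m" "card {l'..<l} = m"
    using assms(1) by (auto simp: m_def)
  have split: "{..<l} = {..<l'} \<union> {l'..<l}"
    using assms(1) by auto
  have fpos: "0 < f a" if "a < l" for a
    using nz nonneg[OF that] that by (auto simp: order_le_less)
  define P where "P = (\<Prod>a<l'. f a)"
  define L where "L = (\<Prod>a=l'..<l. f a)"
  have PL: "0 < P" "0 < L"
    unfolding P_def L_def using fpos assms(1) by (auto intro!: prod_pos)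
  have prod_eq: "(\<Prod>a<l. f a) = P * L"
    unfolding P_def L_def split by (rule prod.union_disjoint) auto
  \<comment> \<open>A heavy axis without a chosen vector would have entry 0 and contradict
    \<open>nz\<close>.\<close>
  have "l' \<le> (\<Sum>a<l'. c a)"
  proof -
    have "(\<Sum>a<l'. 1) \<le> (\<Sum>a<l'. c a)"
      using fpos heavy assms(1) by (intro sum_mono) (metis One_nat_def Suc_leI lessThan_iff less_irrefl less_trans not_gr_zero)
    then show ?thesis by simp
  qed
  moreover have "(\<Sum>a<l. c a) = (\<Sum>a<l'. c a) + (\<Sum>a=l'..<l. c a)"
    unfolding split by (rule sum.union_disjoint) auto
  ultimately have light_sum: "(\<Sum>a=l'..<l. c a) \<le> k - l'"
    using assms(3) by linarith
  have "L powr (1 / real m) \<le> (\<Sum>a=l'..<l. f a / real m)"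
    using arith_geom_mean[of "{l'..<l}" f] fpos m assms(1) unfolding L_def by (auto simp: less_imp_le)
  also have "\<dots> = real (\<Sum>a=l'..<l. c a) / real m"
    using light by (simp add: sum_divide_distrib)
  also have "\<dots> \<le> real (k - l') / real m"
    using light_sum by (intro divide_right_mono) linarith+
  finally have amgm: "L powr (1 / real m) \<le> real (k - l') / real m" .
  have "P \<le> (\<Sum>I | I \<subseteq> {..<l} \<and> card I = l'. prod f I)"
    unfolding P_def using assms(1) nonneg
    by (intro member_le_sum[of _ _ "prod f"]) (auto intro!: prod_nonneg)
  then have "1 / L \<le> (\<Sum>I | I \<subseteq> {..<l} \<and> card I = l'. prod f I) / (\<Prod>a<l. f a)"
    unfolding prod_eq using PL by (simp add: field_simps)
  then have "(1 / L) powr (1 / real m) \<le>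
      ((\<Sum>I | I \<subseteq> {..<l} \<and> card I = l'. prod f I) / (\<Prod>a<l. f a)) powr (1 / real m)"
    using PL by (intro powr_mono2) auto
  moreover have "real m / real (k - l') \<le> (1 / L) powr (1 / real m)"
  proof -
    have "(1 / L) powr (1 / real m) = 1 / L powr (1 / real m)"
      using PL by (simp add: powr_divide)
    moreover have "1 / (real (k - l') / real m) \<le> 1 / L powr (1 / real m)"
      using amgm PL m assms(1,2) by (intro divide_left_mono) auto
    ultimately show ?thesis by simp
  qed
  ultimately show ?thesis
    unfolding m_def by (rule order_trans[rotated])
qed

text \<open>Dividing the term of \<open>I\<close> by the full product leaves the inverses of the
  entries outside \<open>I\<close>. As \<open>t\<close> grows this tends to 0 as soon as a heavy
  axis lies outside \<open>I\<close>, so only \<open>I = {..<l'}\<close> survives in the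
  limit.\<close>

lemma fractional_ratio_tendsto:
  fixes y :: "real \<Rightarrow> real" and l l' :: nat
  defines "f \<equiv> \<lambda>t a. if a < l' then t else y t"
  assumes "l' < l" and y: "(y \<longlongrightarrow> Y) at_top" and "0 < Y"
  shows "((\<lambda>t. ((\<Sum>I | I \<subseteq> {..<l} \<and> card I = l'. prod (f t) I) / (\<Prod>a<l. f t a)) powr (1 / real (l - l')))
    \<longlongrightarrow> 1 / Y) at_top"
proof -
  define m where "m = l - l'"
  have m: "0 < m"
    using assms(2) by (simp add: m_def)
  \<comment> \<open>The limits of the inverse entries.\<close>
  define g where "g = (\<lambda>a. if a < l' then 0 else 1 / Y)"
  have inv: "((\<lambda>t. inverse (f t a)) \<longlongrightarrow> g a) at_top" for a
  proof (cases "a < l'")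
    case True
    then show ?thesis
      by (simp add: f_def g_def tendsto_inverse_0_at_top filterlim_ident)
  next
    case False
    then show ?thesis
      using tendsto_inverse[OF y] \<open>0 < Y\<close> by (simp add: f_def g_def inverse_eq_divide)
  qed
  have lim: "((\<lambda>t. \<Sum>I | I \<subseteq> {..<l} \<and> card I = l'. \<Prod>a\<in>{..<l} - I. inverse (f t a))
      \<longlongrightarrow> (\<Sum>I | I \<subseteq> {..<l} \<and> card I = l'. \<Prod>a\<in>{..<l} - I. g a)) at_top"
    by (intro tendsto_sum tendsto_prod inv)
  have "(\<Sum>I | I \<subseteq> {..<l} \<and> card I = l'. \<Prod>a\<in>{..<l} - I. g a) = (\<Sum>I\<in>{{..<l'}}. \<Prod>a\<in>{..<l} - I. g a)"
  proof (rule sum.mono_neutral_right)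
    show "\<forall>I\<in>{I. I \<subseteq> {..<l} \<and> card I = l'} - {{..<l'}}. (\<Prod>a\<in>{..<l} - I. g a) = 0"
    proof
      fix I assume I: "I \<in> {I. I \<subseteq> {..<l} \<and> card I = l'} - {{..<l'}}"
      then have "finite I"
        by (auto intro: finite_subset)
      \<comment> \<open>Since \<open>I\<close> has exactly \<open>l'\<close> elements, containing
        all heavy axes would force equality with \<open>{..<l'}\<close>.\<close>
      with I have "\<not> {..<l'} \<subseteq> I"
        using card_subset_eq[of I "{..<l'}"] by auto
      then obtain a where "a < l'" "a \<notin> I"
        by auto
      then show "(\<Prod>a\<in>{..<l} - I. g a) = 0"
        using assms(2) by (intro prod_zero) (auto simp: g_def intro!: bexI[of _ a])
    qed
  qed (use assms(2) in auto)
  also have "\<dots> = (\<Prod>a\<in>{l'..<l}. 1 / Y)"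
    by (auto simp: g_def intro!: prod.cong)
  also have "\<dots> = (1 / Y) ^ m"
    by (simp add: m_def)
  finally have lim_eq: "(\<Sum>I | I \<subseteq> {..<l} \<and> card I = l'. \<Prod>a\<in>{..<l} - I. g a) = (1 / Y) ^ m" .
  \<comment> \<open>The cancellation below needs nonzero entries, which are guaranteed only for
    large \<open>t\<close>.\<close>
  have "eventually (\<lambda>t. 0 < t \<and> 0 < y t) at_top"
    using eventually_gt_at_top[of 0] order_tendstoD(1)[OF y \<open>0 < Y\<close>] by eventually_elim auto
  then have "eventually (\<lambda>t. (\<Sum>I | I \<subseteq> {..<l} \<and> card I = l'. \<Prod>a\<in>{..<l} - I. inverse (f t a)) =
      (\<Sum>I | I \<subseteq> {..<l} \<and> card I = l'. prod (f t) I) / (\<Prod>a<l. f t a)) at_top"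
  proof eventually_elim
    case (elim t)
    have fpos: "0 < f t a" for a
      using elim by (simp add: f_def)
    show ?case
      unfolding sum_divide_distrib
    proof (rule sum.cong)
      fix I assume "I \<in> {I. I \<subseteq> {..<l} \<and> card I = l'}"
      then have "(\<Prod>a<l. f t a) = (\<Prod>a\<in>{..<l} - I. f t a) * prod (f t) I"
        by (intro prod.subset_diff) auto
      moreover have "(\<Prod>a\<in>{..<l} - I. inverse (f t a)) = inverse (\<Prod>a\<in>{..<l} - I. f t a)"
        using prod_inversef[of "f t"] by (simp add: o_def)
      moreover have "0 < prod (f t) I" "0 < (\<Prod>a\<in>{..<l} - I. f t a)"
        using fpos by (auto intro!: prod_pos)
      ultimately show "(\<Prod>a\<in>{..<l} - I. inverse (f t a)) = prod (f t) I / (\<Prod>a<l. f t a)"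
        by (simp add: inverse_eq_divide)
    qed simp
  qed
  with lim have "((\<lambda>t. (\<Sum>I | I \<subseteq> {..<l} \<and> card I = l'. prod (f t) I) / (\<Prod>a<l. f t a))
      \<longlongrightarrow> (1 / Y) ^ m) at_top"
    unfolding lim_eq by (rule Lim_transform_eventually)
  then have "((\<lambda>t. ((\<Sum>I | I \<subseteq> {..<l} \<and> card I = l'. prod (f t) I) / (\<Prod>a<l. f t a)) powr (1 / real m))
      \<longlongrightarrow> ((1 / Y) ^ m) powr (1 / real m)) at_top"
    using \<open>0 < Y\<close> by (intro tendsto_powr) auto
  moreover have "((1 / Y) ^ m) powr (1 / real m) = 1 / Y"
    using \<open>0 < Y\<close> m by (simp add: powr_powr flip: powr_realpow)
  ultimately show ?thesis
    by (simp add: m_def)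
qed

section \<open>Bounds on the optimal values of both variants\<close>

lemma ratio_obj_nonneg: "0 \<le> ratio_obj l' l M"
  by (simp add: ratio_obj_def)

lemma CP_rep_nonneg: "0 \<le> CP_rep d k l' l n v"
  unfolding CP_rep_def by (intro INF_greatest ratio_obj_nonneg)

lemma CP_norep_nonneg: "0 \<le> CP_norep d k l' l n v"
  unfolding CP_norep_def by (intro INF_greatest ratio_obj_nonneg)

lemma CP_rep_le_CP_norep: "CP_rep d k l' l n v \<le> CP_norep d k l' l n v"
  unfolding CP_rep_def CP_norep_def by (rule INF_superset_mono) auto

text \<open>A set is a multiset without repetitions. Together with \<open>CP_rep_le_CP_norep\<close>
  this reduces both variants to a lower bound on \<open>OPT_rep\<close> and an upper bound on
  \<open>CP_norep\<close>.\<close>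

lemma OPT_rep_le_OPT_norep: "OPT_rep d k l' l n v \<le> OPT_norep d k l' l n v"
  unfolding OPT_norep_def
proof (rule INF_greatest)
  fix S assume S: "S \<in> {S. S \<subseteq> {1..n} \<and> card S = k}"
  then have "finite S"
    by (auto intro: finite_subset)
  with S show "OPT_rep d k l' l n v \<le> ratio_obj l' l (sub_mat d v (mset_set S) * (sub_mat d v (mset_set S))\<^sup>T)"
    unfolding OPT_rep_def by (intro INF_lower) auto
qed

text \<open>The number of members of \<open>S\<close> in each block plays the role of
  \<open>c\<close> in \<open>integral_ratio_lower_bound\<close>; the heavy scales \<open>s a\<close>
  remain arbitrary.\<close>

lemma OPT_rep_axis_copies_lower_bound:
  assumes "l' < l" and "l \<le> d" and "l \<le> k" and light: "\<And>a. l' \<le> a \<Longrightarrow> s a = 1"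
  shows "ereal (real (l - l') / real (k - l')) \<le> OPT_rep d k l' l (l * k) (axis_copies d k s)"
  unfolding OPT_rep_def
proof (rule INF_greatest)
  fix S assume "S \<in> {S. set_mset S \<subseteq> {1..l * k} \<and> size S = k}"
  then have S: "set_mset S \<subseteq> {1..l * k}" "size S = k"
    by auto
  define c where "c = (\<lambda>a. \<Sum>i\<in>copies (l * k) k a. count S i)"
  define f where "f = (\<lambda>a. (s a)\<^sup>2 * real (c a))"
  have "(\<Sum>a<l. c a) = (\<Sum>i=1..l * k. count S i)"
    unfolding c_def by (rule sum_copies)
  also have "\<dots> = size S"
    unfolding size_multiset_overloaded_eq using S(1)
    by (intro sum.mono_neutral_right) (auto simp: not_in_iff)
  finally have sum_c: "(\<Sum>a<l. c a) = k"
    using S(2) by simp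
  have "ereal (real (l - l') / real (k - l')) \<le>
      (if (\<Prod>a<l. f a) = 0 then \<infinity>
       else ereal (((\<Sum>I | I \<subseteq> {..<l} \<and> card I = l'. prod f I) / (\<Prod>a<l. f a)) powr (1 / real (l - l'))))"
    using integral_ratio_lower_bound[OF assms(1) assms(3) sum_c, of f] light by (simp add: f_def)
  moreover have "f = (\<lambda>a. (s a)\<^sup>2 * (\<Sum>i\<in>copies (l * k) k a. real (count S i)))"
    by (simp add: f_def c_def)
  ultimately show "ereal (real (l - l') / real (k - l')) \<le>
      ratio_obj l' l (sub_mat d (axis_copies d k s) S * (sub_mat d (axis_copies d k s) S)\<^sup>T)"
    unfolding gram_sub_mat[OF S(1)] ratio_obj_axis_copies[OF assms(2)] by (simp only:)
qed

text \<open>This keeps the gap from holding trivially with an infinite optimum: some choice covers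
  all \<open>l\<close> axes, since \<open>l \<le> k\<close>.\<close>

lemma OPT_norep_axis_copies_finite:
  assumes "0 < l" and "l \<le> d" and "l \<le> k" and s: "\<And>a. s a \<noteq> 0"
  shows "OPT_norep d k l' l (l * k) (axis_copies d k s) < \<infinity>"
proof -
  have k: "0 < k"
    using assms by simp
  \<comment> \<open>The first copy on each axis; any \<open>k\<close>-element superset
    \<open>S\<close> then makes the first \<open>l\<close> diagonal entries positive.\<close>
  define A where "A = (\<lambda>a. a * k + 1) ` {..<l}"
  have A_copies: "a * k + 1 \<in> copies (l * k) k a" if "a < l" for a
    using copies_eq[OF k that] k by auto
  have "card A = l"
    unfolding A_def using k by (subst card_image) (auto simp: inj_on_def)
  moreover have "A \<subseteq> {1..l * k}"
    using A_copies unfolding A_def copies_def by blast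
  moreover have "k \<le> l * k"
    using assms(1) by simp
  ultimately obtain S where S: "A \<subseteq> S" "S \<subseteq> {1..l * k}" "card S = k"
    using exists_subset_between[of A k "{1..l * k}"] assms(3) by auto
  have fin: "finite S"
    using S(2) by (rule finite_subset) simp
  have pos: "0 < (\<Sum>i\<in>copies (l * k) k a. real (count (mset_set S) i))" if "a < l" for a
  proof (rule sum_pos2[of _ "a * k + 1"])
    show "0 < real (count (mset_set S) (a * k + 1))"
      using S(1) that fin by (auto simp: A_def)
  qed (use A_copies[OF that] in \<open>auto simp: copies_def\<close>)
  have "(\<Prod>a<l. (s a)\<^sup>2 * (\<Sum>i\<in>copies (l * k) k a. real (count (mset_set S) i))) \<noteq> 0"
    using pos s by (fastforce simp: prod_zero_iff)
  moreover have "set_mset (mset_set S) \<subseteq> {1..l * k}"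
    using S(2) fin by simp
  ultimately have "ratio_obj l' l (sub_mat d (axis_copies d k s) (mset_set S) * (sub_mat d (axis_copies d k s) (mset_set S))\<^sup>T) < \<infinity>"
    by (simp add: gram_sub_mat ratio_obj_axis_copies[OF assms(2)])
  then show ?thesis
    unfolding OPT_norep_def by (rule INF_lower[THEN le_less_trans, rotated]) (use S in simp)
qed

text \<open>The mass \<open>g a\<close> of axis \<open>a\<close> is spread evenly over its
  \<open>k\<close> copies, so \<open>g a \<le> real k\<close> is what makes the point feasible
  without repetitions.\<close>

lemma CP_norep_axis_copies_le:
  fixes g :: "nat \<Rightarrow> real" and s :: "nat \<Rightarrow> real"
  defines "f \<equiv> \<lambda>a. (s a)\<^sup>2 * g a"
  assumes "0 < k" and "l \<le> d" and s: "\<And>a. s a \<noteq> 0"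
    and g: "\<And>a. a < l \<Longrightarrow> 0 < g a" "\<And>a. a < l \<Longrightarrow> g a \<le> real k" and sum_g: "(\<Sum>a<l. g a) = real k"
  shows "CP_norep d k l' l (l * k) (axis_copies d k s) \<le>
    ereal (((\<Sum>I | I \<subseteq> {..<l} \<and> card I = l'. prod f I) / (\<Prod>a<l. f a)) powr (1 / real (l - l')))"
proof -
  define x where "x = (\<lambda>i. g ((i - 1) div k) / real k)"
  have sum_x: "(\<Sum>i\<in>copies (l * k) k a. x i) = g a" if "a < l" for a
  proof -
    have "(\<Sum>i\<in>copies (l * k) k a. x i) = (\<Sum>i\<in>copies (l * k) k a. g a / real k)"
      by (intro sum.cong) (auto simp: x_def copies_def)
    also have "\<dots> = g a"
      using assms(2) by (simp add: copies_eq[OF assms(2) that])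
    finally show ?thesis .
  qed
  have "(\<Sum>i=1..l * k. x i) = real k"
    unfolding sum_copies[symmetric] using sum_x sum_g by simp
  moreover have "0 \<le> x i \<and> x i \<le> 1" if "i \<in> {1..l * k}" for i
  proof -
    have "(i - 1) div k < l"
      using that by (auto simp: less_mult_imp_div_less)
    with g show ?thesis
      using assms(2) by (auto simp: x_def less_imp_le)
  qed
  ultimately have "CP_norep d k l' l (l * k) (axis_copies d k s) \<le>
      ratio_obj l' l (weighted_gram d (l * k) (axis_copies d k s) x)"
    unfolding CP_norep_def by (intro INF_lower) auto
  moreover have "(\<Prod>a<l. (s a)\<^sup>2 * (\<Sum>i\<in>copies (l * k) k a. x i)) = (\<Prod>a<l. f a)"
    by (intro prod.cong) (auto simp: sum_x f_def)
  moreover have "(\<Sum>I | I \<subseteq> {..<l} \<and> card I = l'. \<Prod>a\<in>I. (s a)\<^sup>2 * (\<Sum>i\<in>copies (l * k) k a. x i)) =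
      (\<Sum>I | I \<subseteq> {..<l} \<and> card I = l'. prod f I)"
    by (intro sum.cong prod.cong) (auto simp: sum_x f_def)
  moreover have "(\<Prod>a<l. f a) \<noteq> 0"
    using s g(1) by (fastforce simp: f_def prod_zero_iff)
  ultimately show ?thesis
    by (simp add: ratio_obj_axis_copies[OF assms(3)])
qed

section \<open>Choice of the heavy scale and comparison of the optima\<close>

theorem theoremA11:
  fixes k d l l' :: nat and \<delta> :: real
  assumes "0 < k" and "0 < d" and "l' < l" and "l \<le> d" and "l \<le> k" and "0 < \<delta>"
  shows "(\<exists>(n::nat) (v::nat \<Rightarrow> real vec). (\<forall>i\<in>{1..n}. v i \<in> carrier_vec d) \<and>
            OPT_norep d k l' l n v < \<infinity> \<and>
            OPT_norep d k l' l n v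
              \<ge> ereal (real k / (real k - real l') - \<delta>) * CP_norep d k l' l n v) \<and>
         (\<exists>(n::nat) (v::nat \<Rightarrow> real vec). (\<forall>i\<in>{1..n}. v i \<in> carrier_vec d) \<and>
            OPT_rep d k l' l n v < \<infinity> \<and>
            OPT_rep d k l' l n v
              \<ge> ereal (real k / (real k - real l') - \<delta>) * CP_rep d k l' l n v)"
proof -
  define m where "m = l - l'"
  define C where "C = real k / (real k - real l') - \<delta>"
  \<comment> \<open>Mass \<open>1 / t\<close> on each of the \<open>l'\<close> heavy axes leaves
    \<open>k - l' / t\<close>, shared equally by the \<open>m\<close> light axes.\<close>
  define y where "y = (\<lambda>t. (real k - real l' / t) / real m)"
  define f where "f = (\<lambda>t a. if a < l' then t else y t)"
  define F where "F = (\<lambda>t. ((\<Sum>I | I \<subseteq> {..<l} \<and> card I = l'. prod (f t) I) / (\<Prod>a<l. f t a)) powr (1 / real m))"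
  have m: "0 < m" and kl: "real (k - l') = real k - real l'" "real l' < real k"
    using assms by (auto simp: m_def)
  have "((\<lambda>t. (real k - real l' * inverse t) / real m) \<longlongrightarrow> (real k - real l' * 0) / real m) at_top"
    using m by (intro tendsto_intros tendsto_inverse_0_at_top filterlim_ident) auto
  then have "(y \<longlongrightarrow> real k / real m) at_top"
    by (simp add: y_def divide_inverse)
  from fractional_ratio_tendsto[OF assms(3) this] have F_lim: "(F \<longlongrightarrow> real m / real k) at_top"
    using assms(1) m by (simp add: F_def f_def m_def)
  \<comment> \<open>The loss of \<delta> in the factor gives a strict inequality at the limit value
    of \<open>F\<close>, which therefore persists for some finite \<open>t\<close>.\<close>
  have "C * (real m / real k) = real m / (real k - real l') - \<delta> * real m / real k"
    using kl assms(1) by (simp add: C_def field_simps)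
  also have "\<dots> < real m / (real k - real l')"
    using assms(1,6) m by simp
  finally have "C * (real m / real k) < real m / (real k - real l')" .
  then have "eventually (\<lambda>t. C * F t < real m / (real k - real l')) at_top"
    by (intro order_tendstoD(2)[OF tendsto_mult_left[OF F_lim]])
  \<comment> \<open>The extra bound on \<open>t\<close> makes the heavy mass \<open>1 / t\<close> at
    most 1 and, through \<open>l' / t < 1\<close>, the light mass positive.\<close>
  then have "eventually (\<lambda>t. C * F t < real m / (real k - real l') \<and> real l' + 1 \<le> t) at_top"
    using eventually_ge_at_top by (rule eventually_conj)
  then obtain t where t: "C * F t < real m / (real k - real l')" "real l' + 1 \<le> t"
    unfolding eventually_at_top_linorder by blast
  then have t1: "1 \<le> t" "real l' / t < 1"
    by auto
  \<comment> \<open>The Gram matrix squares the scale, so a heavy axis gets the entry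
    \<open>t^2 * (1 / t) = t\<close>.\<close>
  define s where "s = (\<lambda>a. if a < l' then t else 1)"
  define g where "g = (\<lambda>a. if a < l' then 1 / t else y t)"
  define v where "v = axis_copies d k s"
  have s: "s a \<noteq> 0" for a
    using t1 by (simp add: s_def)
  have y_pos: "0 < y t"
  proof -
    have "1 \<le> real k"
      using assms(1) by simp
    with t1(2) have "0 < real k - real l' / t"
      by linarith
    then show ?thesis
      using m by (simp add: y_def)
  qed
  have y_le: "y t \<le> real k"
  proof -
    have "y t \<le> real k / real m"
      unfolding y_def using t1 by (intro divide_right_mono) auto
    also have "\<dots> \<le> real k"
      using m by (simp add: divide_le_eq mult_le_cancel_left1)
    finally show ?thesis .
  qed
  have g: "0 < g a" "g a \<le> real k" for a
  proof -
    have "1 / t \<le> 1"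
      using t1 by simp
    moreover have "1 \<le> real k"
      using assms(1) by simp
    ultimately have "1 / t \<le> real k"
      by linarith
    then show "0 < g a" "g a \<le> real k"
      using t1(1) y_pos y_le by (auto simp: g_def)
  qed
  have "(\<Sum>a<l. g a) = (\<Sum>a<l'. g a) + (\<Sum>a=l'..<l. g a)"
  proof -
    have "{..<l} = {..<l'} \<union> {l'..<l}"
      using assms(3) by auto
    then show ?thesis
      by (simp add: sum.union_disjoint ivl_disj_int)
  qed
  also have "\<dots> = real l' / t + real m * y t"
    by (simp add: g_def m_def)
  also have "\<dots> = real k"
    using m by (simp add: y_def)
  finally have sum_g: "(\<Sum>a<l. g a) = real k" .
  have "(s a)\<^sup>2 * g a = f t a" for a
    using t1 by (auto simp: s_def g_def f_def power2_eq_square)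
  with CP_norep_axis_copies_le[of k l d s g l', OF assms(1,4) s g sum_g]
  have CP: "CP_norep d k l' l (l * k) v \<le> ereal (F t)"
    by (simp add: v_def F_def m_def)
  \<comment> \<open>A large \<delta> makes \<open>C\<close> negative. Multiplication by
    \<open>C\<close> is then no longer monotone, but nonnegativity of \<open>X\<close>
    suffices.\<close>
  have gap: "ereal C * X \<le> ereal (real m / (real k - real l'))" if "0 \<le> X" "X \<le> ereal (F t)" for X
  proof (cases "0 \<le> C")
    case True
    then have "ereal C * X \<le> ereal C * ereal (F t)"
      using that(2) by (intro ereal_mult_left_mono) auto
    also have "\<dots> \<le> ereal (real m / (real k - real l'))"
      using t(1) by simp
    finally show ?thesis .
  next
    case False
    then have "ereal C * X \<le> 0"
      using that(1) by (simp add: ereal_mult_le_0_iff)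
    also have "0 \<le> ereal (real m / (real k - real l'))"
      using kl by simp
    finally show ?thesis .
  qed
  have OPT: "ereal (real m / (real k - real l')) \<le> OPT_rep d k l' l (l * k) v"
    using OPT_rep_axis_copies_lower_bound[OF assms(3,4,5), of s] kl by (simp add: s_def v_def m_def)
  have fin: "OPT_norep d k l' l (l * k) v < \<infinity>"
    unfolding v_def using assms s by (intro OPT_norep_axis_copies_finite) auto
  have carrier: "\<forall>i\<in>{1..l * k}. v i \<in> carrier_vec d"
    by (simp add: v_def axis_copies_def)
  show ?thesis
    unfolding C_def[symmetric]
  proof (intro conjI exI)
    show "ereal C * CP_norep d k l' l (l * k) v \<le> OPT_norep d k l' l (l * k) v"
      using gap[OF CP_norep_nonneg CP] OPT OPT_rep_le_OPT_norep by (meson order_trans)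
    show "ereal C * CP_rep d k l' l (l * k) v \<le> OPT_rep d k l' l (l * k) v"
      using gap[OF CP_rep_nonneg order_trans[OF CP_rep_le_CP_norep CP]] OPT by (meson order_trans)
    show "OPT_rep d k l' l (l * k) v < \<infinity>"
      using fin OPT_rep_le_OPT_norep by (rule le_less_trans[rotated])
  qed (use carrier fin in auto)
qed

end
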